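(* Let $\rho \in \mathbb{R}$. The following are equivalent: $(i)$ for all $f$ smooth enough, $\Gamma_2^W(f) \geq \rho\, \Gamma^W(f)$; $(ii)$ for all $f$ smooth enough and all $t \geq 0$, $$\Gamma^W(Q_t f) \leq e^{-2\rho t} Q_t(\Gamma^W(f));$$ $(iii)$ for all $f$ smooth enough and all $t \geq 0$, $$Q_t(f^2) - (Q_t f)^2 + 2 \int_0^t Q_s \left( W^2 (Q_{t-s} f)^2 \right) ds \leq \frac{1-e^{-2\rho t}}{\rho}\, Q_t (\Gamma^W(f)),$$ where, when $\rho=0$, the ratio $\frac{1-e^{-2\rho t}}{\rho}$ is understood as its limit $2t$.
   Context: Let $U \colon \mathbb{R}^n \to \mathbb{R}$ be twice differentiable with $\int_{\mathbb{R}^n} e^{-U(x)}\,dx = 1$, so that $\mu(dx)=e^{-U(x)}dx$ is a probability measure on $\mathbb{R}^n$. Let $L=\Delta - \nabla U \cdot \nabla$ (where $\cdot$ is the Euclidean scalar product), a diffusion operator symmetric in $\mathbb{L}_2(\mu)$, and let $(Q_t)_{t \geq 0}$ be the semi-group associated to (generated by) $L$. The carré du champ is $\Gamma(f,g) = \frac12\left(L(fg) - fLg - gLf\right) = \nabla f\cdot\nabla g$, and $\Gamma(f):=\Gamma(f,f)=|\nabla f|^2$. Let $W \colon \mathbb{R}^n \to \mathbb{R}_+ = [0,\infty)$ be smooth enough, so that in particular $W^2$ belongs to the domain of $L$. For $f,g \colon \mathbb{R}^n \to \mathbb{R}$ smooth enough, set $$\Gamma^W(f,g):=\Gamma(f,g)+W^2fg,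 \qquad \Gamma^W(f):=\Gamma^W(f,f)=|\nabla f|^2+W^2f^2,$$ $$\Gamma_2^W(f,g) := \frac{1}{2} \left( L\Gamma^W(f,g)- \Gamma^W(Lf,g) - \Gamma^W(f,Lg) \right), \qquad \Gamma_2^W(f):=\Gamma_2^W(f,f).$$ Inequalities between functions are pointwise on $\mathbb{R}^n$. "Smooth enough" means regular enough that all the quantities involved (and the usual $\Gamma_2$-calculus manipulations of them) are well defined. *)

theory Defs
  imports "HOL-Probability.Probability"
begin

definition pd :: "'n \<Rightarrow> (real ^ 'n \<Rightarrow> real) \<Rightarrow> real ^ 'n \<Rightarrow> real" where
  "pd i f x = frechet_derivative f (at x) (axis i 1)"

definition grad :: "(real ^ 'n \<Rightarrow> real) \<Rightarrow> real ^ 'n \<Rightarrow> real ^ 'n" where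
  "grad f x = (\<chi> i. pd i f x)"

definition laplacian :: "(real ^ 'n \<Rightarrow> real) \<Rightarrow> real ^ 'n \<Rightarrow> real" where
  "laplacian f x = (\<Sum>i\<in>UNIV. pd i (pd i f) x)"

definition twice_differentiable :: "(real ^ 'n \<Rightarrow> real) \<Rightarrow> bool" where
  "twice_differentiable f \<longleftrightarrow>
     (\<forall>x. f differentiable (at x)) \<and> (\<forall>i x. pd i f differentiable (at x))"

definition diffusion_op :: "(real ^ 'n \<Rightarrow> real) \<Rightarrow> (real ^ 'n \<Rightarrow> real) \<Rightarrow> real ^ 'n \<Rightarrow> real" where
  "diffusion_op U f x = laplacian f x - grad U x \<bullet> grad f x"

definition Gam ::
  "(real ^ 'n \<Rightarrow> real) \<Rightarrow> (real ^ 'n \<Rightarrow> real) \<Rightarrow> (real ^ 'n \<Rightarrow> real) \<Rightarrow> real ^ 'n \<Rightarrow> real" where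
  "Gam U f g x = 1 / 2 * (diffusion_op U (\<lambda>y. f y * g y) x
                           - f x * diffusion_op U g x - g x * diffusion_op U f x)"

definition GamW ::
  "(real ^ 'n \<Rightarrow> real) \<Rightarrow> (real ^ 'n \<Rightarrow> real) \<Rightarrow> (real ^ 'n \<Rightarrow> real) \<Rightarrow> (real ^ 'n \<Rightarrow> real)
     \<Rightarrow> real ^ 'n \<Rightarrow> real" where
  "GamW U W f g x = Gam U f g x + (W x)\<^sup>2 * f x * g x"

definition Gam2W ::
  "(real ^ 'n \<Rightarrow> real) \<Rightarrow> (real ^ 'n \<Rightarrow> real) \<Rightarrow> (real ^ 'n \<Rightarrow> real) \<Rightarrow> (real ^ 'n \<Rightarrow> real)
     \<Rightarrow> real ^ 'n \<Rightarrow> real" where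
  "Gam2W U W f g x = 1 / 2 * (diffusion_op U (GamW U W f g) x
                               - GamW U W (diffusion_op U f) g x
                               - GamW U W f (diffusion_op U g) x)"

definition gibbs :: "(real ^ 'n \<Rightarrow> real) \<Rightarrow> (real ^ 'n) measure" where
  "gibbs U = density lborel (\<lambda>x. ennreal (exp (- U x)))"

text \<open>Inequalities between functions are meant at every point, so the Markov semigroup is
  represented by its transition kernels \<open>P t x\<close> rather than by operators on classes of functions
  modulo null sets.\<close>

definition Q ::
  "(real \<Rightarrow> real ^ 'n \<Rightarrow> (real ^ 'n) measure) \<Rightarrow> real \<Rightarrow> (real ^ 'n \<Rightarrow> real) \<Rightarrow> real ^ 'n \<Rightarrow> real" where
  "Q P t f x = (\<integral>y. f y \<partial>P t x)"

text \<open>The domain of the generator, in pointwise form: \<open>t \<mapsto> Q P t f x\<close> is continuously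
  differentiable on \<open>[0, \<infinity>)\<close> with derivative \<open>Q P t (diffusion_op U f) x\<close>. The integrability
  clauses matter because the Bochner integral of a non-integrable function is 0.\<close>

definition in_domain ::
  "(real ^ 'n \<Rightarrow> real) \<Rightarrow> (real \<Rightarrow> real ^ 'n \<Rightarrow> (real ^ 'n) measure) \<Rightarrow> (real ^ 'n \<Rightarrow> real) \<Rightarrow> bool" where
  "in_domain U P f \<longleftrightarrow>
     twice_differentiable f \<and>
     (\<forall>t\<ge>0. \<forall>x. integrable (P t x) f \<and> integrable (P t x) (diffusion_op U f)) \<and>
     (\<forall>t\<ge>0. \<forall>x. ((\<lambda>s. Q P s f x) has_real_derivative Q P t (diffusion_op U f) x)
                    (at t within {0..})) \<and>
     (\<forall>x. continuous_on {0..} (\<lambda>t. Q P t (diffusion_op U f) x))"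

definition test_function :: "(real ^ 'n \<Rightarrow> real) \<Rightarrow> bool" where
  "test_function f \<longleftrightarrow>
     twice_differentiable f \<and> (\<forall>i j. continuous_on UNIV (pd i (pd j f))) \<and>
     compact (closure {x. f x \<noteq> 0})"

text \<open>Since \<open>diffusion_op U\<close> is essentially self-adjoint on compactly supported functions
  in \<open>L\<^sup>2(gibbs U)\<close>, the last two clauses determine the semigroup.\<close>

definition semigroup_generated_by ::
  "(real ^ 'n \<Rightarrow> real) \<Rightarrow> (real \<Rightarrow> real ^ 'n \<Rightarrow> (real ^ 'n) measure) \<Rightarrow> bool" where
  "semigroup_generated_by U P \<longleftrightarrow>
     (\<forall>t\<ge>0. P t \<in> borel \<rightarrow>\<^sub>M prob_algebra borel) \<and>
     (\<forall>x. P 0 x = return borel x) \<and>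
     (\<forall>s\<ge>0. \<forall>t\<ge>0. \<forall>x. P (s + t) x = P s x \<bind> P t) \<and>
     (\<forall>t\<ge>0. \<forall>f\<in>borel_measurable borel. \<forall>g\<in>borel_measurable borel.
        integrable (gibbs U) (\<lambda>x. (f x)\<^sup>2) \<longrightarrow> integrable (gibbs U) (\<lambda>x. (g x)\<^sup>2) \<longrightarrow>
        (\<integral>x. f x * Q P t g x \<partial>gibbs U) = (\<integral>x. g x * Q P t f x \<partial>gibbs U)) \<and>
     (\<forall>f. test_function f \<longrightarrow> in_domain U P f)"

text \<open>An admissible class of smooth functions is stable under the operator and the semigroup, and
  the three bilinear expressions from which all the functionals are built stay in the domain and
  depend continuously on time. Nothing is assumed about how these expressions differentiate in
  time along the semigroup.\<close>

definition regular_form ::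
  "(real ^ 'n \<Rightarrow> real) \<Rightarrow> (real \<Rightarrow> real ^ 'n \<Rightarrow> (real ^ 'n) measure) \<Rightarrow> (real ^ 'n \<Rightarrow> real) set
     \<Rightarrow> ((real ^ 'n \<Rightarrow> real) \<Rightarrow> (real ^ 'n \<Rightarrow> real) \<Rightarrow> real ^ 'n \<Rightarrow> real) \<Rightarrow> bool" where
  "regular_form U P A B \<longleftrightarrow>
     (\<forall>f\<in>A. \<forall>g\<in>A. in_domain U P (B f g)) \<and>
     (\<forall>f\<in>A. \<forall>g\<in>A. \<forall>x.
        continuous_on ({0..} \<times> {0..}) (\<lambda>(s, u). Q P s (B (Q P u f) (Q P u g)) x))"

definition smooth_class ::
  "(real ^ 'n \<Rightarrow> real) \<Rightarrow> (real ^ 'n \<Rightarrow> real) \<Rightarrow> (real \<Rightarrow> real ^ 'n \<Rightarrow> (real ^ 'n) measure)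
     \<Rightarrow> (real ^ 'n \<Rightarrow> real) set \<Rightarrow> bool" where
  "smooth_class U W P A \<longleftrightarrow>
     (\<forall>f\<in>A. in_domain U P f) \<and>
     (\<forall>f\<in>A. diffusion_op U f \<in> A) \<and>
     (\<forall>f\<in>A. \<forall>t\<ge>0. Q P t f \<in> A) \<and>
     regular_form U P A (\<lambda>f g x. f x * g x) \<and>
     regular_form U P A (Gam U) \<and>
     regular_form U P A (\<lambda>f g x. (W x)\<^sup>2 * f x * g x)"

lemma pd_mult:
  fixes f g :: "real ^ 'n \<Rightarrow> real"
  assumes "f differentiable (at x)" "g differentiable (at x)"
  shows "pd i (\<lambda>y. f y * g y) x = f x * pd i g x + pd i f x * g x"
proof -
  have "((\<lambda>y. f y * g y) has_derivative
      (\<lambda>h. f x * frechet_derivative g (at x) h + frechet_derivative f (at x) h * g x)) (at x)"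
    using assms by (intro has_derivative_mult) (simp_all add: frechet_derivative_works)
  from frechet_derivative_at[OF this] show ?thesis
    unfolding pd_def by (metis (no_types, lifting))
qed

lemma pd_add:
  fixes f g :: "real ^ 'n \<Rightarrow> real"
  assumes "f differentiable (at x)" "g differentiable (at x)"
  shows "pd i (\<lambda>y. f y + g y) x = pd i f x + pd i g x"
proof -
  have "((\<lambda>y. f y + g y) has_derivative
      (\<lambda>h. frechet_derivative f (at x) h + frechet_derivative g (at x) h)) (at x)"
    using assms by (intro has_derivative_add) (simp_all add: frechet_derivative_works)
  from frechet_derivative_at[OF this] show ?thesis
    unfolding pd_def by (metis (no_types, lifting))
qed

lemma Gam_eq_grad_inner_grad:
  fixes f g :: "real ^ 'n \<Rightarrow> real"
  assumes f: "twice_differentiable f" and g: "twice_differentiable g"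
  shows "Gam U f g x = grad f x \<bullet> grad g x"
proof -
  note df = f[unfolded twice_differentiable_def] and dg = g[unfolded twice_differentiable_def]
  have 1: "pd i (\<lambda>y. f y * g y) = (\<lambda>y. f y * pd i g y + pd i f y * g y)" for i
    using df dg by (auto intro!: ext pd_mult)
  have 2: "pd i (pd i (\<lambda>y. f y * g y)) x =
      f x * pd i (pd i g) x + 2 * (pd i f x * pd i g x) + pd i (pd i f) x * g x" for i
    unfolding 1 using df dg
    by (simp add: pd_add pd_mult differentiable_mult)
  have 3: "laplacian (\<lambda>y. f y * g y) x =
      f x * laplacian g x + 2 * (grad f x \<bullet> grad g x) + laplacian f x * g x"
    unfolding laplacian_def 2
    by (simp add: sum.distrib sum_distrib_left sum_distrib_right inner_vec_def grad_def)
  have 4: "grad U x \<bullet> grad (\<lambda>y. f y * g y) x =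
      f x * (grad U x \<bullet> grad g x) + g x * (grad U x \<bullet> grad f x)"
    by (simp add: inner_vec_def grad_def 1 algebra_simps sum.distrib sum_distrib_left)
  show ?thesis
    unfolding Gam_def diffusion_op_def 3 4 by (simp add: algebra_simps)
qed

end

theory Submission
  imports Defs "HOL-Real_Asymp.Real_Asymp"
begin

text \<open>Fix a point \<open>x\<close> and a function \<open>f\<close> of the class. For a bilinear expression \<open>B\<close> put
  \<open>F\<^sub>B(s, u) = Q\<^sub>s(B(Q\<^sub>u f, Q\<^sub>u f))(x)\<close> for \<open>s, u \<ge> 0\<close>. Everything happens on the antidiagonals
  \<open>s + u = t\<close>. There \<open>F\<close> with \<open>B = \<Gamma>\<^sup>W\<close> runs from \<open>\<Gamma>\<^sup>W(Q\<^sub>t f)(x)\<close> at \<open>s = 0\<close> to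
  \<open>Q\<^sub>t(\<Gamma>\<^sup>W(f))(x)\<close> at \<open>s = t\<close>, and its derivative is \<open>2 Q\<^sub>s(\<Gamma>\<^sub>2\<^sup>W(Q\<^sub>t\<^sub>-\<^sub>s f))(x)\<close>. Moreover the left-hand
  side of the Poincare inequality (iii) is twice the integral of \<open>F\<close> along the antidiagonal
  (\<open>energy_identity\<close>), because \<open>F\<close> with \<open>B(f, g) = f g\<close> has antidiagonal derivative
  \<open>2 Q\<^sub>s(\<Gamma>(Q\<^sub>t\<^sub>-\<^sub>s f))(x)\<close>. The three implications are then short. From (i), the function
  \<open>e\<^sup>-\<^sup>2\<^sup>\<rho>\<^sup>s F(s, t - s)\<close> is nondecreasing, which is (ii). From (ii) at time \<open>t - s\<close>, positivity of \<open>Q\<^sub>s\<close>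
  gives \<open>F(s, t - s) \<le> e\<^sup>-\<^sup>2\<^sup>\<rho>\<^sup>(\<^sup>t\<^sup>-\<^sup>s\<^sup>) Q\<^sub>t(\<Gamma>\<^sup>W(f))(x)\<close>, and integrating in \<open>s\<close> gives (iii). Finally
  both sides of (iii) agree to first order at \<open>t = 0\<close>, and comparing the terms of order \<open>t\<^sup>2\<close> gives (i).\<close>

text \<open>The substance lies in differentiating \<open>F\<close> along the antidiagonal. The \<open>s\<close>-derivative is the defining
  property of the domain. For the \<open>u\<close>-derivative one expects the Leibniz rule
  \<open>\<partial>\<^sub>u Q\<^sub>s(B(Q\<^sub>u f, Q\<^sub>u g)) = Q\<^sub>s(B(Q\<^sub>u L f, Q\<^sub>u g)) + Q\<^sub>s(B(Q\<^sub>u f, Q\<^sub>u L g))\<close>. For the weighted products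
  \<open>B(f, g) = w f g\<close> it is pointwise calculus under the kernel integral, justified by Fubini's theorem
  (\<open>DERIV_product_flow\<close>). For \<open>\<Gamma>\<close> a direct argument would have to exchange the spatial gradient with the time
  derivative of \<open>Q\<^sub>u f\<close>. This is avoided as follows. With \<open>G\<close> the function for the unweighted product, the
  definition of \<open>\<Gamma>\<close> by \<open>L\<close> says that \<open>F\<^sub>\<Gamma> = (\<partial>\<^sub>s G - \<partial>\<^sub>u G) / 2\<close>. So the Leibniz rule for \<open>\<Gamma>\<close> amounts to
  the symmetry \<open>\<partial>\<^sub>u \<partial>\<^sub>s G = \<partial>\<^sub>s \<partial>\<^sub>u G\<close> of the mixed derivatives of a function of two real variables, and
  \<open>\<partial>\<^sub>s \<partial>\<^sub>u G\<close> exists and is continuous because \<open>\<partial>\<^sub>u G\<close> is again a sum of such product functions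
  (\<open>DERIV_Gam_flow\<close>).\<close>

section \<open>Calculus on the closed quadrant\<close>

lemma DERIV_unique_atLeast_0:
  fixes f :: "real \<Rightarrow> real"
  assumes "(f has_real_derivative a) (at x within {0..})"
    and "(f has_real_derivative b) (at x within {0..})"
    and "x \<ge> 0"
  shows "a = b"
proof -
  have "x islimpt {0..}"
    by (rule islimpt_subset[of x "{x..x+1}"]) (use assms(3) in auto)
  then show ?thesis
    using assms(1,2) unfolding has_real_derivative_iff_has_vector_derivative
    by (intro vector_derivative_unique_within[of x "{0..}" f]) (auto simp: trivial_limit_within)
qed

lemma DERIV_indefinite_integral_atLeast_0:
  fixes g h :: "real \<Rightarrow> real"
  assumes cont: "continuous_on {0..} h"
    and g: "\<And>v. v \<ge> 0 \<Longrightarrow> g v = c + integral {0..v} h"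
    and u: "u \<ge> 0"
  shows "(g has_real_derivative h u) (at u within {0..})"
proof -
  have "((\<lambda>v. integral {0..v} h) has_real_derivative h u) (at u within {0..u+1})"
    by (rule integral_has_real_derivative) (use u in \<open>auto intro: continuous_on_subset[OF cont]\<close>)
  then have "((\<lambda>v. c + integral {0..v} h) has_real_derivative h u) (at u within {0..u+1})"
    by (auto intro!: derivative_eq_intros)
  also have "at u within {0..u+1} = at u within {0..}"
    by (rule at_within_nhd[of u "{..<u+1}"]) auto
  finally show ?thesis
    by (rule has_field_derivative_transform_within[where d=1]) (use u g in auto)
qed

text \<open>Symmetry of mixed derivatives, where the existence of the second mixed derivative is part of the
  conclusion: integrate \<open>\<partial>\<^sub>u G = H\<close> in \<open>u\<close>, differentiate under the integral in \<open>s\<close>,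
  and read off \<open>\<partial>\<^sub>s G\<close> as a primitive of \<open>K = \<partial>\<^sub>s H\<close>.\<close>

lemma DERIV_mixed_partial:
  fixes G Gs H K :: "real \<Rightarrow> real \<Rightarrow> real"
  assumes Gs: "\<And>s u. s \<ge> 0 \<Longrightarrow> u \<ge> 0 \<Longrightarrow> ((\<lambda>s. G s u) has_real_derivative Gs s u) (at s within {0..})"
    and Gu: "\<And>s u. s \<ge> 0 \<Longrightarrow> u \<ge> 0 \<Longrightarrow> ((\<lambda>u. G s u) has_real_derivative H s u) (at u within {0..})"
    and Hs: "\<And>s u. s \<ge> 0 \<Longrightarrow> u \<ge> 0 \<Longrightarrow> ((\<lambda>s. H s u) has_real_derivative K s u) (at s within {0..})"
    and H: "\<And>s. s \<ge> 0 \<Longrightarrow> continuous_on {0..} (H s)"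
    and K: "continuous_on ({0..} \<times> {0..}) (\<lambda>(s, u). K s u)"
    and s: "s \<ge> 0" and u: "u \<ge> 0"
  shows "((\<lambda>u. Gs s u) has_real_derivative K s u) (at u within {0..})"
proof (rule DERIV_indefinite_integral_atLeast_0[OF _ _ u])
  have "continuous_on {0..} (\<lambda>u::real. (s, u))"
    by (intro continuous_on_Pair continuous_on_const continuous_on_id)
  from continuous_on_compose2[OF K this] show "continuous_on {0..} (K s)"
    using s by auto
  fix v :: real assume v: "v \<ge> 0"
  have "((\<lambda>s. integral (cbox 0 v) (H s)) has_field_derivative integral (cbox 0 v) (K s)) (at s within {0..})"
    by (rule leibniz_rule_field_derivative)
       (use s v Hs K in \<open>auto intro!: integrable_continuous_real intro: continuous_on_subset continuous_on_subset[OF H]\<close>)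
  moreover have "integral {0..v} (H r) = G r v - G r 0" if "r \<ge> 0" for r
    by (intro integral_unique fundamental_theorem_of_calculus[OF v])
       (auto simp: has_real_derivative_iff_has_vector_derivative[symmetric] intro: DERIV_subset[OF Gu[OF that]])
  ultimately have "((\<lambda>r. G r v - G r 0) has_real_derivative integral {0..v} (K s)) (at s within {0..})"
    using s by (auto elim!: has_field_derivative_transform_within[where d=1])
  moreover have "((\<lambda>r. G r v - G r 0) has_real_derivative Gs s v - Gs s 0) (at s within {0..})"
    using s v by (intro DERIV_diff Gs) auto
  ultimately show "Gs s v = Gs s 0 + integral {0..v} (K s)"
    using DERIV_unique_atLeast_0 s by fastforce
qed

text \<open>Continuity is asked of the \<open>u\<close>-derivative only. This matters since \<open>s \<mapsto> Q\<^sub>s(L(B(Q\<^sub>u f, Q\<^sub>u g)))\<close> is known to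
  be continuous for each fixed \<open>u\<close> but not jointly in \<open>s\<close> and \<open>u\<close>.\<close>

lemma has_derivative_quadrant:
  fixes F D :: "real \<Rightarrow> real \<Rightarrow> real"
  assumes Fs: "((\<lambda>s. F s u) has_real_derivative a) (at s within {0..})"
    and Fu: "\<And>s u. s \<ge> 0 \<Longrightarrow> u \<ge> 0 \<Longrightarrow> ((\<lambda>u. F s u) has_real_derivative D s u) (at u within {0..})"
    and D: "continuous_on ({0..} \<times> {0..}) (\<lambda>(s, u). D s u)"
    and s: "s \<ge> 0" and u: "u \<ge> 0"
  shows "((\<lambda>(s, u). F s u) has_derivative (\<lambda>(p, q). a * p + D s u * q)) (at (s, u) within {0..} \<times> {0..})"
proof -
  have "((\<lambda>(s, u). F s u) has_derivative
      (\<lambda>(p, q). a * p + blinfun_apply (blinfun_mult_right (D s u)) q)) (at (s, u) within {0..} \<times> {0..})"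
  proof (rule has_derivative_partialsI)
    show "((\<lambda>s. F s u) has_derivative (*) a) (at s within {0..})"
      using Fs by (simp add: has_field_derivative_def)
    show "((\<lambda>v. F r v) has_derivative blinfun_apply (blinfun_mult_right (D r v)) ) (at v within {0..})"
      if "r \<in> {0..}" "v \<in> {0..}" for r v :: real
      using Fu[of r v] that by (simp add: has_field_derivative_def)
    have "continuous_on ({0..} \<times> {0..}) (\<lambda>z. blinfun_mult_right ((\<lambda>(s, u). D s u) z))"
      by (intro bounded_linear.continuous_on[OF bounded_linear_blinfun_mult_right] D)
    then show "continuous (at (s, u) within {0..} \<times> {0..}) (\<lambda>(r, v). blinfun_mult_right (D r v))"
      using s u by (auto simp: continuous_on_eq_continuous_within case_prod_unfold)
  qed (use u in auto)
  then show ?thesis by simp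
qed

lemma DERIV_antidiagonal:
  fixes F :: "real \<Rightarrow> real \<Rightarrow> real"
  assumes "((\<lambda>(s, u). F s u) has_derivative (\<lambda>(p, q). a * p + b * q)) (at (s, t - s) within {0..} \<times> {0..})"
  shows "((\<lambda>s. F s (t - s)) has_real_derivative a - b) (at s within {0..t})"
proof -
  have "((\<lambda>s. (s, t - s)) has_derivative (\<lambda>h. (h, - h))) (at s within {0..t})"
    by (auto intro!: derivative_eq_intros)
  moreover have "(\<lambda>s. (s, t - s)) ` {0..t} \<subseteq> {0..} \<times> {0..}"
    by auto
  ultimately have "((\<lambda>s. F s (t - s)) has_derivative (\<lambda>h. a * h + b * (- h))) (at s within {0..t})"
    using has_derivative_in_compose[of "\<lambda>s. (s, t - s)" "\<lambda>h. (h, - h)" s "{0..t}" "\<lambda>(s, u). F s u"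
        "\<lambda>(p, q). a * p + b * q"] has_derivative_subset[OF assms]
    by simp
  also have "(\<lambda>h. a * h + b * (- h)) = (*) (a - b)"
    by (auto simp: algebra_simps)
  finally show ?thesis
    by (simp add: has_field_derivative_def)
qed

text \<open>The second-order expansion at \<open>t = 0\<close> of the antidiagonal integral. Total differentiability at the corner
  suffices: on the antidiagonal \<open>s + u = t\<close> the first-order error is \<open>o(t)\<close>, so its integral is \<open>o(t\<^sup>2)\<close>, and
  the linear part averages to \<open>t (a + b) / 2\<close>.\<close>

lemma tendsto_antidiagonal_integral:
  fixes F :: "real \<Rightarrow> real \<Rightarrow> real"
  assumes F: "((\<lambda>(s, u). F s u) has_derivative (\<lambda>(p, q). a * p + b * q)) (at (0, 0) within {0..} \<times> {0..})"
    and cont: "\<And>t. t \<ge> 0 \<Longrightarrow> continuous_on {0..t} (\<lambda>s. F s (t - s))"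
  shows "((\<lambda>t. (integral {0..t} (\<lambda>s. F s (t - s)) - t * F 0 0) / t\<^sup>2) \<longlongrightarrow> (a + b) / 2) (at_right 0)"
proof (rule tendstoI)
  fix e :: real assume "e > 0"
  define e' where "e' = e / 2"
  have e': "e' > 0" "e' < e" using \<open>e > 0\<close> by (auto simp: e'_def)
  obtain d where d: "d > 0" and dF:
    "\<And>s u. s \<ge> 0 \<Longrightarrow> u \<ge> 0 \<Longrightarrow> norm (s, u) < d \<Longrightarrow>
       \<bar>F s u - F 0 0 - (a * s + b * u)\<bar> \<le> e' * norm (s, u)"
    using F e' unfolding has_derivative_within_alt by fastforce
  have "dist ((integral {0..t} (\<lambda>s. F s (t - s)) - t * F 0 0) / t\<^sup>2) ((a + b) / 2) < e"
    if t: "0 < t" "t < d" for t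
  proof -
    have poly: "((\<lambda>s. F 0 0 + (a * s + b * (t - s))) has_integral t * F 0 0 + (a + b) / 2 * t\<^sup>2) {0..t}"
    proof -
      have "((\<lambda>s. F 0 0 + (a * s + b * (t - s))) has_integral
         (F 0 0 * t + (a * t\<^sup>2 / 2 + b * (t * t - t\<^sup>2 / 2))) - (F 0 0 * 0 + (a * 0\<^sup>2 / 2 + b * (t * 0 - 0\<^sup>2 / 2)))) {0..t}"
        by (rule fundamental_theorem_of_calculus)
           (use t in \<open>auto intro!: derivative_eq_intros
              simp: has_real_derivative_iff_has_vector_derivative[symmetric]\<close>)
      then show ?thesis by (simp add: field_simps power2_eq_square)
    qed
    have Fint: "(\<lambda>s. F s (t - s)) integrable_on {0..t}"
      using cont t by (intro integrable_continuous_real) auto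
    have bound: "\<bar>F s (t - s) - (F 0 0 + (a * s + b * (t - s)))\<bar> \<le> e' * t" if "s \<in> {0..t}" for s
    proof -
      have "norm (s, t - s) \<le> t"
        using norm_Pair_le[of s "t - s"] that by auto
      with dF[of s "t - s"] that t e' show ?thesis
        by (smt (verit) atLeastAtMost_iff mult_left_mono)
    qed
    have "continuous_on {0..t} (\<lambda>s. F s (t - s) - (F 0 0 + (a * s + b * (t - s))))"
      using cont[of t] t by (intro continuous_on_diff) (auto intro!: continuous_intros)
    then have "\<bar>integral {0..t} (\<lambda>s. F s (t - s) - (F 0 0 + (a * s + b * (t - s))))\<bar> \<le> e' * t * (t - 0)"
      using integral_bound[of 0 t "\<lambda>s. F s (t - s) - (F 0 0 + (a * s + b * (t - s)))" "e' * t"] bound t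
      by auto
    then have "\<bar>integral {0..t} (\<lambda>s. F s (t - s)) - (t * F 0 0 + (a + b) / 2 * t\<^sup>2)\<bar> \<le> e' * t\<^sup>2"
      using integral_diff[OF Fint has_integral_integrable[OF poly]] integral_unique[OF poly]
      by (simp add: power2_eq_square)
    then have "\<bar>integral {0..t} (\<lambda>s. F s (t - s)) - (t * F 0 0 + (a + b) / 2 * t\<^sup>2)\<bar> / \<bar>t\<^sup>2\<bar> \<le> e'"
      using t by (simp add: field_simps)
    then have "\<bar>(integral {0..t} (\<lambda>s. F s (t - s)) - (t * F 0 0 + (a + b) / 2 * t\<^sup>2)) / t\<^sup>2\<bar> \<le> e'"
      by (simp only: abs_divide)
    also have "(integral {0..t} (\<lambda>s. F s (t - s)) - (t * F 0 0 + (a + b) / 2 * t\<^sup>2)) / t\<^sup>2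
       = (integral {0..t} (\<lambda>s. F s (t - s)) - t * F 0 0) / t\<^sup>2 - (a + b) / 2"
      using t by (simp add: field_simps)
    finally show ?thesis using e' by (simp add: dist_real_def)
  qed
  then show "\<forall>\<^sub>F t in at_right 0.
      dist ((integral {0..t} (\<lambda>s. F s (t - s)) - t * F 0 0) / t\<^sup>2) ((a + b) / 2) < e"
    using d eventually_at_right[of 0 1] by (auto simp: eventually_at_right_field)
qed

lemma curvature_factor_asymptotics:
  fixes \<rho> :: real
  defines "c \<equiv> \<lambda>t. if \<rho> = 0 then 2 * t else (1 - exp (- 2 * \<rho> * t)) / \<rho>"
  shows "((\<lambda>t. c t / t) \<longlongrightarrow> 2) (at_right 0)"
    and "((\<lambda>t. (c t - 2 * t) / t\<^sup>2) \<longlongrightarrow> - 2 * \<rho>) (at_right 0)"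
proof -
  consider "\<rho> = 0" | "\<rho> > 0" | "\<rho> < 0" by linarith
  then have "((\<lambda>t. c t / t) \<longlongrightarrow> 2) (at_right 0) \<and> ((\<lambda>t. (c t - 2 * t) / t\<^sup>2) \<longlongrightarrow> - 2 * \<rho>) (at_right 0)"
  proof cases
    case 1
    have "((\<lambda>t::real. 2 * t / t) \<longlongrightarrow> 2) (at_right 0)" by real_asymp
    then show ?thesis using 1 unfolding c_def by simp
  next
    case 2
    have "((\<lambda>t. (1 - exp (- 2 * \<rho> * t)) / \<rho> / t) \<longlongrightarrow> 2) (at_right 0)"
      "((\<lambda>t. ((1 - exp (- 2 * \<rho> * t)) / \<rho> - 2 * t) / t\<^sup>2) \<longlongrightarrow> - 2 * \<rho>) (at_right 0)"
      using 2 by (real_asymp simp: power2_eq_square)+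
    then show ?thesis using 2 unfolding c_def by simp
  next
    case 3
    have "((\<lambda>t. (1 - exp (- 2 * \<rho> * t)) / \<rho> / t) \<longlongrightarrow> 2) (at_right 0)"
      "((\<lambda>t. ((1 - exp (- 2 * \<rho> * t)) / \<rho> - 2 * t) / t\<^sup>2) \<longlongrightarrow> - 2 * \<rho>) (at_right 0)"
      using 3 by (real_asymp simp: power2_eq_square)+
    then show ?thesis using 3 unfolding c_def by simp
  qed
  then show "((\<lambda>t. c t / t) \<longlongrightarrow> 2) (at_right 0)"
    and "((\<lambda>t. (c t - 2 * t) / t\<^sup>2) \<longlongrightarrow> - 2 * \<rho>) (at_right 0)" by auto
qed

text \<open>The constant in the Poincare inequality is the time integral of the exponential factors of the gradient bound.\<close>

lemma curvature_factor_integral: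
  fixes \<rho> t :: real
  assumes "t \<ge> 0"
  shows "((\<lambda>s. 2 * exp (- 2 * \<rho> * (t - s))) has_integral
    (if \<rho> = 0 then 2 * t else (1 - exp (- 2 * \<rho> * t)) / \<rho>)) {0..t}"
proof (cases "\<rho> = 0")
  case True
  then show ?thesis using has_integral_const_real[of "2::real" 0 t] assms by (simp add: mult.commute)
next
  case False
  have "((\<lambda>s. 2 * exp (- 2 * \<rho> * (t - s))) has_integral
      exp (- 2 * \<rho> * (t - t)) / \<rho> - exp (- 2 * \<rho> * (t - 0)) / \<rho>) {0..t}"
    by (rule fundamental_theorem_of_calculus[OF assms])
       (use False in \<open>auto intro!: derivative_eq_intros
          simp: has_real_derivative_iff_has_vector_derivative[symmetric]\<close>)
  then show ?thesis using False by (simp add: diff_divide_distrib)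
qed


section \<open>Domain, measurability and composition of kernels\<close>

lemma twice_differentiable_continuous_on:
  assumes "twice_differentiable f"
  shows "continuous_on UNIV f"
  using assms unfolding twice_differentiable_def
  by (metis continuous_at_imp_continuous_on differentiable_imp_continuous_within)

lemma in_domain_borel_measurable:
  assumes "in_domain U P f"
  shows "f \<in> borel_measurable borel"
  using assms twice_differentiable_continuous_on borel_measurable_continuous_onI
  unfolding in_domain_def by blast

lemma twice_differentiable_add:
  fixes f g :: "real ^ 'n \<Rightarrow> real"
  assumes f: "twice_differentiable f" and g: "twice_differentiable g"
  shows "twice_differentiable (\<lambda>x. f x + g x)"
    and "diffusion_op U (\<lambda>x. f x + g x) x = diffusion_op U f x + diffusion_op U g x"
proof -
  note df = f[unfolded twice_differentiable_def] and dg = g[unfolded twice_differentiable_def]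
  have 1: "pd i (\<lambda>y. f y + g y) = (\<lambda>y. pd i f y + pd i g y)" for i
    using df dg by (auto intro!: ext pd_add)
  show "twice_differentiable (\<lambda>x. f x + g x)"
    using df dg by (simp add: twice_differentiable_def 1)
  have 2: "pd i (pd i (\<lambda>y. f y + g y)) x = pd i (pd i f) x + pd i (pd i g) x" for i
    unfolding 1 using df dg by (intro pd_add) auto
  have 3: "grad (\<lambda>y. f y + g y) x = grad f x + grad g x"
    by (simp add: grad_def 1 vec_eq_iff)
  show "diffusion_op U (\<lambda>x. f x + g x) x = diffusion_op U f x + diffusion_op U g x"
    unfolding diffusion_op_def 3 laplacian_def 2 by (simp add: sum.distrib inner_add_right)
qed

text \<open>Approximating \<open>r\<close> by \<open>\<lfloor>n r\<rfloor> / n\<close> leaves only countably many sections \<open>h r\<close> to be considered.\<close>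

lemma measurable_separately_continuous:
  fixes h :: "real \<Rightarrow> 'a::topological_space \<Rightarrow> real"
  assumes cont: "\<And>y. continuous_on UNIV (\<lambda>r. h r y)"
    and meas: "\<And>r. h r \<in> borel_measurable M"
  shows "(\<lambda>(r, y). h r y) \<in> borel_measurable (borel \<Otimes>\<^sub>M M)"
proof (rule borel_measurable_LIMSEQ_real)
  show "(\<lambda>(r, y). h (real_of_int \<lfloor>real (Suc n) * r\<rfloor> / real (Suc n)) y) \<in> borel_measurable (borel \<Otimes>\<^sub>M M)" for n
    using measurable_compose_countable[of "\<lambda>k z. h (real_of_int k / real (Suc n)) (snd z)" "borel \<Otimes>\<^sub>M M" borel
        "\<lambda>z. \<lfloor>real (Suc n) * fst z\<rfloor>"] meas
    by (simp add: case_prod_unfold)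
  fix z :: "real \<times> 'a" assume "z \<in> space (borel \<Otimes>\<^sub>M M)"
  obtain r :: real and y where z: "z = (r, y)" by (metis surj_pair)
  have "(\<lambda>n. real_of_int \<lfloor>real (Suc n) * r\<rfloor> / real (Suc n)) \<longlonglongrightarrow> r"
  proof (rule LIMSEQ_I, goal_cases)
    case (1 e)
    obtain N where N: "inverse (real (Suc N)) < e" using reals_Archimedean 1 by blast
    have "norm (real_of_int \<lfloor>real (Suc n) * r\<rfloor> / real (Suc n) - r) < e" if "n \<ge> N" for n
    proof -
      have "\<bar>real_of_int \<lfloor>real (Suc n) * r\<rfloor> - real (Suc n) * r\<bar> \<le> 1" by linarith
      then have "\<bar>real_of_int \<lfloor>real (Suc n) * r\<rfloor> - real (Suc n) * r\<bar> / real (Suc n) \<le> 1 / real (Suc n)"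
        by (rule divide_right_mono) simp
      also have "\<bar>real_of_int \<lfloor>real (Suc n) * r\<rfloor> - real (Suc n) * r\<bar> / real (Suc n)
        = \<bar>(real_of_int \<lfloor>real (Suc n) * r\<rfloor> - real (Suc n) * r) / real (Suc n)\<bar>"
        by (simp only: abs_divide)
      also have "(real_of_int \<lfloor>real (Suc n) * r\<rfloor> - real (Suc n) * r) / real (Suc n) = 
         real_of_int \<lfloor>real (Suc n) * r\<rfloor> / real (Suc n) - r"
        by (simp add: field_simps)
      also have "1 / real (Suc n) \<le> inverse (real (Suc N))"
        using that by (simp add: field_simps)
      finally show ?thesis using N by simp
    qed
    then show ?case by blast
  qed
  then have "(\<lambda>n. h (real_of_int \<lfloor>real (Suc n) * r\<rfloor> / real (Suc n)) y) \<longlonglongrightarrow> h r y"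
    using cont[of y] by (auto simp: continuous_on_eq_continuous_at intro: isCont_tendsto_compose)
  then show "(\<lambda>n. (\<lambda>(r, y). h (real_of_int \<lfloor>real (Suc n) * r\<rfloor> / real (Suc n)) y) z) \<longlonglongrightarrow> (\<lambda>(r, y). h r y) z"
    by (simp add: z)
qed

lemma nonneg_integral_bind:
  fixes f :: "'a \<Rightarrow> real"
  assumes N: "N \<in> M \<rightarrow>\<^sub>M subprob_algebra B"
    and f[measurable]: "f \<in> borel_measurable B" and pos: "\<And>x. f x \<ge> 0"
    and int: "integrable (M \<bind> N) f" and intN: "\<And>y. y \<in> space M \<Longrightarrow> integrable (N y) f"
  shows "has_bochner_integral M (\<lambda>y. \<integral>x. f x \<partial>N y) (\<integral>x. f x \<partial>(M \<bind> N))"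
proof (rule has_bochner_integral_nn_integral)
  show "(\<lambda>y. \<integral>x. f x \<partial>N y) \<in> borel_measurable M"
    using measurable_compose[OF N integral_measurable_subprob_algebra[OF f]] by simp
  have "(\<integral>\<^sup>+y. ennreal (\<integral>x. f x \<partial>N y) \<partial>M) = (\<integral>\<^sup>+y. \<integral>\<^sup>+x. ennreal (f x) \<partial>N y \<partial>M)"
    using intN pos by (intro nn_integral_cong) (simp add: nn_integral_eq_integral)
  also have "\<dots> = (\<integral>\<^sup>+x. ennreal (f x) \<partial>(M \<bind> N))"
    by (rule nn_integral_bind[symmetric, OF _ N]) measurable
  also have "\<dots> = ennreal (\<integral>x. f x \<partial>(M \<bind> N))"
    using int pos by (intro nn_integral_eq_integral) auto
  finally show "(\<integral>\<^sup>+y. ennreal (\<integral>x. f x \<partial>N y) \<partial>M) = ennreal (\<integral>x. f x \<partial>(M \<bind> N))" .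
qed (use pos in auto)

text \<open>This lifts the Chapman-Kolmogorov equation from kernels to integrals of unbounded functions.\<close>

lemma has_bochner_integral_bind:
  fixes f :: "'a \<Rightarrow> real"
  assumes N: "N \<in> M \<rightarrow>\<^sub>M subprob_algebra B"
    and f[measurable]: "f \<in> borel_measurable B"
    and int: "integrable (M \<bind> N) f" and intN: "\<And>y. y \<in> space M \<Longrightarrow> integrable (N y) f"
  shows "has_bochner_integral M (\<lambda>y. \<integral>x. f x \<partial>N y) (\<integral>x. f x \<partial>(M \<bind> N))"
proof -
  define p where "p x = max 0 (f x)" for x
  define m where "m x = max 0 (- f x)" for x
  have pm: "f x = p x - m x" for x by (auto simp: p_def m_def)
  have ip: "integrable K p" and im: "integrable K m" if "integrable K f" for K
    using that unfolding p_def m_def by (auto intro: integrable_max)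
  have [measurable]: "p \<in> borel_measurable B" "m \<in> borel_measurable B"
    unfolding p_def m_def by measurable
  have "has_bochner_integral M (\<lambda>y. (\<integral>x. p x \<partial>N y) - (\<integral>x. m x \<partial>N y))
      ((\<integral>x. p x \<partial>(M \<bind> N)) - (\<integral>x. m x \<partial>(M \<bind> N)))"
    using int intN ip im
    by (intro has_bochner_integral_diff nonneg_integral_bind[OF N]) (auto simp: p_def m_def)
  moreover have "(\<integral>x. f x \<partial>K) = (\<integral>x. p x \<partial>K) - (\<integral>x. m x \<partial>K)" if "integrable K f" for K
    unfolding pm using ip[OF that] im[OF that] by simp
  ultimately show ?thesis
    using int intN by (simp cong: has_bochner_integral_cong)
qed

section \<open>The semigroup on an admissible class\<close>

locale smooth_semigroup =
  fixes U W :: "real ^ 'n \<Rightarrow> real"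
    and P :: "real \<Rightarrow> real ^ 'n \<Rightarrow> (real ^ 'n) measure"
    and A :: "(real ^ 'n \<Rightarrow> real) set"
  assumes semigroup: "semigroup_generated_by U P"
    and smooth: "smooth_class U W P A"
    and potential: "in_domain U P (\<lambda>x. (W x)\<^sup>2)"
begin

abbreviation L where "L \<equiv> diffusion_op U"
abbreviation T where "T \<equiv> Q P"

lemma kernel: "t \<ge> 0 \<Longrightarrow> P t \<in> borel \<rightarrow>\<^sub>M prob_algebra borel"
  using semigroup by (auto simp: semigroup_generated_by_def)

lemma kernel_prob_space: "t \<ge> 0 \<Longrightarrow> prob_space (P t x)"
  and sets_kernel [simp, measurable_cong]: "t \<ge> 0 \<Longrightarrow> sets (P t x) = sets borel"
  using measurable_space[OF kernel, of t x] by (auto simp: space_prob_algebra)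

lemma T_0: "f \<in> borel_measurable borel \<Longrightarrow> T 0 f = f"
  using semigroup integral_return[of _ borel f]
  by (auto simp: semigroup_generated_by_def Q_def)

lemma T_T:
  assumes "s \<ge> 0" "t \<ge> 0" and f: "\<And>t x. t \<ge> 0 \<Longrightarrow> integrable (P t x) f"
  shows "T s (T t f) x = T (s + t) f x" and "integrable (P s x) (T t f)"
proof -
  have CK: "P (s + t) x = P s x \<bind> P t"
    using semigroup assms by (auto simp: semigroup_generated_by_def)
  have N: "P t \<in> P s x \<rightarrow>\<^sub>M subprob_algebra borel"
    using measurable_prob_algebraD[OF kernel[OF assms(2)]] sets_kernel[OF assms(1)]
    by (metis measurable_cong_sets)
  have fm: "f \<in> borel_measurable borel"
    using borel_measurable_integrable[OF f[of 0]] sets_kernel[of 0] by (simp cong: measurable_cong_sets)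
  have "has_bochner_integral (P s x) (\<lambda>y. \<integral>z. f z \<partial>P t y) (\<integral>z. f z \<partial>(P s x \<bind> P t))"
    using f assms(1,2) CK by (intro has_bochner_integral_bind[OF N fm]) (metis add_nonneg_nonneg, auto)
  then show "T s (T t f) x = T (s + t) f x" "integrable (P s x) (T t f)"
    using CK by (auto simp: has_bochner_integral_iff Q_def[abs_def])
qed

lemma in_domain_A: "f \<in> A \<Longrightarrow> in_domain U P f"
  and L_A: "f \<in> A \<Longrightarrow> L f \<in> A"
  and T_A: "f \<in> A \<Longrightarrow> t \<ge> 0 \<Longrightarrow> T t f \<in> A"
  and regular_Gam: "regular_form U P A (Gam U)"
  and regular_prod: "regular_form U P A (\<lambda>f g x. f x * g x)"
  and regular_potential: "regular_form U P A (\<lambda>f g x. (W x)\<^sup>2 * f x * g x)"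
  using smooth by (auto simp: smooth_class_def)

lemma in_domain_integrable:
  assumes "in_domain U P f" "t \<ge> 0"
  shows "integrable (P t x) f" "integrable (P t x) (L f)"
  using assms by (auto simp: in_domain_def)

lemma DERIV_T:
  assumes "in_domain U P f" "t \<ge> 0"
  shows "((\<lambda>t. T t f x) has_real_derivative T t (L f) x) (at t within {0..})"
  using assms by (auto simp: in_domain_def)

lemma A_integrable: "f \<in> A \<Longrightarrow> t \<ge> 0 \<Longrightarrow> integrable (P t x) f"
  and A_borel_measurable: "f \<in> A \<Longrightarrow> f \<in> borel_measurable borel"
  by (auto intro: in_domain_integrable in_domain_A in_domain_borel_measurable)

lemma T_T_A: "f \<in> A \<Longrightarrow> s \<ge> 0 \<Longrightarrow> t \<ge> 0 \<Longrightarrow> T s (T t f) = T (s + t) f"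
  by (intro ext T_T) (auto intro: A_integrable)

text \<open>Both sides are the right derivative at \<open>0\<close> of \<open>s \<mapsto> Q\<^sub>s\<^sub>+\<^sub>t f x\<close>: the left one because \<open>Q\<^sub>t f\<close> lies in the
  domain, the right one because \<open>f\<close> does.\<close>

lemma L_T:
  assumes f: "f \<in> A" and t: "t \<ge> 0"
  shows "L (T t f) = T t (L f)"
proof
  fix x
  have "((\<lambda>s. T s (T t f) x) has_real_derivative T 0 (L (T t f)) x) (at 0 within {0..})"
    using f t by (intro DERIV_T in_domain_A T_A) auto
  then have 1: "((\<lambda>s. T (s + t) f x) has_real_derivative L (T t f) x) (at 0 within {0..})"
    using f t by (simp add: T_0 A_borel_measurable T_A L_A)
       (erule has_field_derivative_transform_within[where d=1], auto simp: T_T_A)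
  have "((\<lambda>r. T r f x) has_real_derivative T t (L f) x) (at (0 + t) within (\<lambda>s. s + t) ` {0..})"
    by (rule DERIV_subset[of _ _ _ "{0..}"]) (use DERIV_T[OF in_domain_A[OF f] t] t in auto)
  then have "((\<lambda>r. T r f x) \<circ> (\<lambda>s. s + t) has_real_derivative T t (L f) x * 1) (at 0 within {0..})"
    by (rule DERIV_image_chain) (auto intro!: derivative_eq_intros)
  with 1 show "L (T t f) x = T t (L f) x"
    using DERIV_unique_atLeast_0[of _ "L (T t f) x" 0 "T t (L f) x"] by (simp add: o_def)
qed

lemma DERIV_T_A: 
  assumes "f \<in> A" "t \<ge> 0"
  shows "((\<lambda>t. T t f x) has_real_derivative T t (L f) x) (at t within {0..})"
  using assms by (intro DERIV_T in_domain_A)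

lemma continuous_on_T_A: 
  assumes "f \<in> A"
  shows "continuous_on {0..} (\<lambda>t. T t f x)"
  using DERIV_continuous[OF DERIV_T_A[OF assms]] by (auto simp: continuous_on_eq_continuous_within)

section \<open>The two-parameter functions and their derivatives\<close>

text \<open>The outer time \<open>s\<close> and the inner time \<open>u\<close> are kept independent; the classical interpolation argument is the
  restriction to \<open>u = t - s\<close>.\<close>

definition flow where "flow B f g x s u = T s (B (T u f) (T u g)) x"

lemma DERIV_flow_outer:
  assumes "regular_form U P A B" "f \<in> A" "g \<in> A" "s \<ge> 0" "u \<ge> 0"
  shows "((\<lambda>s. flow B f g x s u) has_real_derivative T s (L (B (T u f) (T u g))) x) (at s within {0..})"
  unfolding flow_def using assms by (intro DERIV_T) (auto simp: regular_form_def T_A)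

lemma continuous_on_flow:
  assumes "regular_form U P A B" "f \<in> A" "g \<in> A"
  shows "continuous_on ({0..} \<times> {0..}) (\<lambda>(s, u). flow B f g x s u)"
  unfolding flow_def using assms by (auto simp: regular_form_def)

lemma continuous_on_flow_inner:
  assumes "regular_form U P A B" "f \<in> A" "g \<in> A" "s \<ge> 0"
  shows "continuous_on {0..} (flow B f g x s)"
proof -
  have "continuous_on {0..} (\<lambda>u::real. (s, u))"
    by (intro continuous_on_Pair continuous_on_const continuous_on_id)
  from continuous_on_compose2[OF continuous_on_flow[OF assms(1-3)] this] show ?thesis
    using assms(4) by auto
qed


text \<open>The semigroup is extended by \<open>max 0 r\<close> to negative times, where the kernels are arbitrary, so that one can
  integrate against Lebesgue measure on the whole line.\<close>

lemma measurable_T_joint: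
  assumes "f \<in> A"
  shows "(\<lambda>(r, y). T (max 0 r) f y) \<in> borel_measurable (borel \<Otimes>\<^sub>M borel)"
proof (rule measurable_separately_continuous)
  show "continuous_on UNIV (\<lambda>r. T (max 0 r) f y)" for y
    by (rule continuous_on_compose2[OF continuous_on_T_A[OF assms]]) (auto intro!: continuous_intros)
  show "T (max 0 r) f \<in> borel_measurable borel" for r
    using assms by (intro A_borel_measurable T_A) auto
qed

text \<open>By \<open>2 |a b| \<le> a\<^sup>2 + b\<^sup>2\<close> the space integrals are dominated by the diagonal terms \<open>Q\<^sub>s(w (Q\<^sub>r a)\<^sup>2)\<close> and
  \<open>Q\<^sub>s(w (Q\<^sub>r b)\<^sup>2)\<close>, which are continuous in \<open>r\<close> and hence bounded on the time interval.\<close>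

lemma integrable_product_flow:
  assumes w: "\<And>x. w x \<ge> 0" "continuous_on UNIV w"
    and R: "regular_form U P A (\<lambda>f g x. w x * f x * g x)"
    and a: "a \<in> A" and b: "b \<in> A" and s: "s \<ge> 0"
  shows "integrable (lborel \<Otimes>\<^sub>M P s x)
    (\<lambda>(r, y). indicator {0..v} r * (w y * T (max 0 r) a y * T (max 0 r) b y))"
proof -
  let ?B = "\<lambda>f g x. w x * f x * g x"
  interpret K: prob_space "P s x" by (rule kernel_prob_space[OF s])
  interpret pair_sigma_finite lborel "P s x" ..
  note [measurable_cong] = sets_kernel[OF s]
  note [measurable] = measurable_T_joint[OF a] measurable_T_joint[OF b]
    borel_measurable_continuous_onI[OF w(2)]
  define k where "k r y = w y * T (max 0 r) a y * T (max 0 r) b y" for r y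
  have k: "(\<lambda>(r, y). indicator {0..v} r * k r y) \<in> borel_measurable (lborel \<Otimes>\<^sub>M P s x)"
    unfolding k_def by measurable
  have int: "integrable (P s x) (?B (T r f) (T r g))" if "r \<ge> 0" "f \<in> A" "g \<in> A" for r f g
    using R that s by (auto simp: regular_form_def T_A intro: in_domain_integrable)
  let ?h = "\<lambda>r. (flow ?B a a x s r + flow ?B b b x s r) / 2"
  have kh: "(\<integral>y. \<bar>k r y\<bar> \<partial>P s x) \<le> ?h r" if "r \<ge> 0" for r
  proof -
    have "(\<integral>y. \<bar>k r y\<bar> \<partial>P s x) \<le> (\<integral>y. (?B (T r a) (T r a) y + ?B (T r b) (T r b) y) / 2 \<partial>P s x)"
    proof (rule integral_mono)
      fix y
      have "2 * \<bar>T r a y * T r b y\<bar> \<le> T r a y * T r a y + T r b y * T r b y"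
        using sum_squares_bound[of "\<bar>T r a y\<bar>" "\<bar>T r b y\<bar>"] by (simp add: power2_eq_square abs_mult)
      from mult_left_mono[OF this w(1)[of y]] w(1)[of y]
      show "\<bar>k r y\<bar> \<le> (?B (T r a) (T r a) y + ?B (T r b) (T r b) y) / 2"
        using that by (simp add: k_def abs_mult algebra_simps)
    qed (use int[OF that] a b that in \<open>auto simp: k_def\<close>)
    also have "\<dots> = ?h r"
      using int[OF that] a b that by (simp add: flow_def Q_def)
    finally show ?thesis .
  qed
  have "continuous_on {0..v} ?h"
    by (intro continuous_on_divide continuous_on_add continuous_on_const
        continuous_on_subset[OF continuous_on_flow_inner[OF R a a s]]
        continuous_on_subset[OF continuous_on_flow_inner[OF R b b s]]) auto
  then have "integrable lborel (\<lambda>r. indicator {0..v} r *\<^sub>R ?h r)"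
    using borel_integrable_atLeastAtMost' unfolding set_integrable_def by blast
  then have "integrable lborel (\<lambda>r. \<integral>y. norm (case (r, y) of (r, y) \<Rightarrow> indicator {0..v} r * k r y) \<partial>P s x)"
  proof (rule Bochner_Integration.integrable_bound)
    show "(\<lambda>r. \<integral>y. norm (case (r, y) of (r, y) \<Rightarrow> indicator {0..v} r * k r y) \<partial>P s x) \<in> borel_measurable lborel"
    proof -
      have "(\<lambda>(r, y). norm (indicator {0..v} r * k r y)) \<in> borel_measurable (lborel \<Otimes>\<^sub>M P s x)"
        using measurable_compose[OF k borel_measurable_norm] by (simp add: case_prod_unfold)
      from K.borel_measurable_lebesgue_integral[OF this] show ?thesis by simp
    qed
    show "AE r in lborel. norm (\<integral>y. norm (case (r, y) of (r, y) \<Rightarrow> indicator {0..v} r * k r y) \<partial>P s x)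
        \<le> norm (indicator {0..v} r *\<^sub>R ?h r)"
      using kh by (intro AE_I2) (auto simp: indicator_def intro: order_trans[OF _ abs_ge_self])
  qed
  moreover have "AE r in lborel. integrable (P s x) (\<lambda>y. case (r, y) of (r, y) \<Rightarrow> indicator {0..v} r * k r y)"
    using int a b by (intro AE_I2) (auto simp: indicator_def k_def)
  ultimately show ?thesis
    using Fubini_integrable[OF k] by (simp add: k_def)
qed

text \<open>For fixed \<open>y\<close> the increment of \<open>w y * Q\<^sub>u f y * Q\<^sub>u g y\<close> in \<open>u\<close> is the time integral of its derivative; Fubini's theorem
  moves the integral against \<open>P s x\<close> inside, where the result is a continuous function of time.\<close>

lemma DERIV_product_flow:
  assumes w: "\<And>x. w x \<ge> 0" "continuous_on UNIV w"
    and R: "regular_form U P A (\<lambda>f g x. w x * f x * g x)"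
    and f: "f \<in> A" and g: "g \<in> A" and s: "s \<ge> 0" and u: "u \<ge> 0"
  defines "B \<equiv> \<lambda>f g x. w x * f x * g x"
  shows "((\<lambda>u. flow B f g x s u) has_real_derivative flow B (L f) g x s u + flow B f (L g) x s u)
    (at u within {0..})"
proof -
  note R' = R[folded B_def]
  let ?h = "\<lambda>u. flow B (L f) g x s u + flow B f (L g) x s u"
  interpret K: prob_space "P s x" by (rule kernel_prob_space[OF s])
  interpret pair_sigma_finite lborel "P s x" ..
  have int: "integrable (P s x) (B (T r a) (T r b))" if "r \<ge> 0" "a \<in> A" "b \<in> A" for r a b
    using R' that s by (auto simp: regular_form_def T_A intro: in_domain_integrable)
  have cont: "continuous_on {0..} ?h"
    using f g s by (intro continuous_on_add continuous_on_flow_inner[OF R'] L_A)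
  show ?thesis
  proof (rule DERIV_indefinite_integral_atLeast_0[OF cont _ u])
    fix v :: real assume v: "v \<ge> 0"
    define k where "k r y = w y * T (max 0 r) (L f) y * T (max 0 r) g y
      + w y * T (max 0 r) f y * T (max 0 r) (L g) y" for r y
    have "integrable (lborel \<Otimes>\<^sub>M P s x) (\<lambda>(r, y). indicator {0..v} r * k r y)"
      using Bochner_Integration.integrable_add[OF
          integrable_product_flow[OF w R L_A[OF f] g s, of x v]
          integrable_product_flow[OF w R f L_A[OF g] s, of x v]]
      by (simp add: k_def case_prod_unfold distrib_left)
    note fub = Fubini_integral[OF this]
    have time: "(\<integral>r. indicator {0..v} r * k r y \<partial>lborel) = B (T v f) (T v g) y - B (T 0 f) (T 0 g) y" for y
    proof -
      have "has_bochner_integral lborel (\<lambda>r. indicator {0..v} r *\<^sub>R k r y)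
          (B (T v f) (T v g) y - B (T 0 f) (T 0 g) y)"
      proof (rule has_bochner_integral_FTC_Icc[OF v])
        fix r assume r: "0 \<le> r" "r \<le> v"
        have "((\<lambda>r. B (T r f) (T r g) y) has_real_derivative k r y) (at r within {0..v})"
          unfolding B_def k_def using r
          by (auto intro!: derivative_eq_intros DERIV_subset[OF DERIV_T_A[OF f]] DERIV_subset[OF DERIV_T_A[OF g]])
        then show "((\<lambda>r. B (T r f) (T r g) y) has_vector_derivative k r y) (at r within {0..v})"
          by (simp add: has_real_derivative_iff_has_vector_derivative)
      next
        have "continuous_on {0..v} (\<lambda>r. T (max 0 r) a y)" if "a \<in> A" for a
          by (rule continuous_on_compose2[OF continuous_on_T_A[OF that]]) (auto intro!: continuous_intros)
        then show "continuous_on {0..v} (\<lambda>r. k r y)"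
          unfolding k_def using f g by (intro continuous_intros) (auto intro: L_A)
      qed
      then show ?thesis by (simp add: has_bochner_integral_iff)
    qed
    have space: "(\<integral>y. indicator {0..v} r * k r y \<partial>P s x) = indicator {0..v} r * ?h r" for r
      using int[of r "L f" g] int[of r f "L g"] f g
      by (auto simp: indicator_def k_def flow_def Q_def B_def L_A)
    have "set_integrable lborel {0..v} ?h"
      by (rule borel_integrable_atLeastAtMost') (rule continuous_on_subset[OF cont], auto)
    from set_borel_integral_eq_integral(2)[OF this]
    have "integral {0..v} ?h = (\<integral>r. indicator {0..v} r * ?h r \<partial>lborel)"
      by (simp add: set_lebesgue_integral_def)
    also have "\<dots> = (\<integral>y. B (T v f) (T v g) y - B (T 0 f) (T 0 g) y \<partial>P s x)"
      using fub by (simp only: time space)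
    also have "\<dots> = flow B f g x s v - flow B f g x s 0"
      using int[of v f g] int[of 0 f g] f g v by (simp add: flow_def Q_def[of P s])
    finally show "flow B f g x s v = flow B f g x s 0 + integral {0..v} ?h" by simp
  qed
qed

abbreviation mul :: "(real ^ 'n \<Rightarrow> real) \<Rightarrow> (real ^ 'n \<Rightarrow> real) \<Rightarrow> real ^ 'n \<Rightarrow> real"
  where "mul f g x \<equiv> f x * g x"

lemma DERIV_mul_flow:
  assumes "f \<in> A" "g \<in> A" "s \<ge> 0" "u \<ge> 0"
  shows "((\<lambda>u. flow mul f g x s u) has_real_derivative flow mul (L f) g x s u + flow mul f (L g) x s u)
    (at u within {0..})"
  using DERIV_product_flow[of "\<lambda>_. 1"] assms regular_prod by simp

text \<open>This is the definition of \<open>\<Gamma>\<close> read as a formula for \<open>L(f g)\<close>; together with \<open>DERIV_mul_flow\<close> it expresses the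
  flow of \<open>\<Gamma>\<close> by first derivatives of the flow of the product.\<close>

lemma outer_derivative_mul:
  assumes f: "f \<in> A" and g: "g \<in> A" and s: "s \<ge> 0" and u: "u \<ge> 0"
  shows "T s (L (mul (T u f) (T u g))) x
    = 2 * flow (Gam U) f g x s u + flow mul (L f) g x s u + flow mul f (L g) x s u"
proof -
  have "L (mul (T u f) (T u g)) y
      = 2 * Gam U (T u f) (T u g) y + T u (L f) y * T u g y + T u f y * T u (L g) y" for y
    using f g u by (simp add: Gam_def L_T algebra_simps)
  moreover have "integrable (P s x) (B (T u a) (T u b))" if "a \<in> A" "b \<in> A" "regular_form U P A B" for a b B
    using that u s by (auto simp: regular_form_def T_A intro: in_domain_integrable)
  note this[OF f g regular_Gam] this[OF L_A[OF f] g regular_prod] this[OF f L_A[OF g] regular_prod]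
  ultimately show ?thesis
    by (simp add: flow_def Q_def[of P s])
qed

lemma DERIV_mul_flow_outer:
  assumes f: "f \<in> A" and g: "g \<in> A" and s: "s \<ge> 0" and u: "u \<ge> 0"
  shows "((\<lambda>s. flow mul f g x s u) has_real_derivative 
    2 * flow (Gam U) f g x s u + flow mul (L f) g x s u + flow mul f (L g) x s u) (at s within {0..})"
  using DERIV_flow_outer[OF regular_prod assms] outer_derivative_mul[OF assms] by simp

text \<open>Half of \<open>\<partial>\<^sub>s - \<partial>\<^sub>u\<close> applied to the product flow is the flow of \<open>\<Gamma>\<close>, so it suffices to differentiate these two
  terms in \<open>u\<close>. The second is a sum of product flows; the first is handled by the symmetry of mixed
  derivatives.\<close>

lemma DERIV_Gam_flow:
  assumes f: "f \<in> A" and g: "g \<in> A" and s: "s \<ge> 0" and u: "u \<ge> 0"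
  shows "((\<lambda>u. flow (Gam U) f g x s u) has_real_derivative
    flow (Gam U) (L f) g x s u + flow (Gam U) f (L g) x s u) (at u within {0..})"
proof -
  let ?H = "\<lambda>s u. flow mul (L f) g x s u + flow mul f (L g) x s u"
  let ?d = "\<lambda>a b s u. 2 * flow (Gam U) a b x s u + flow mul (L a) b x s u + flow mul a (L b) x s u"
  let ?K = "\<lambda>s u. ?d (L f) g s u + ?d f (L g) s u"
  note fg = f g L_A[OF f] L_A[OF g] L_A[OF L_A[OF f]] L_A[OF L_A[OF g]]
  have "((\<lambda>u. ?d f g s u) has_real_derivative ?K s u) (at u within {0..})"
  proof (rule DERIV_mixed_partial[where G="\<lambda>s u. flow mul f g x s u" and H="?H" and Gs="?d f g" and K="?K"])
    fix s u :: real assume su: "s \<ge> 0" "u \<ge> 0"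
    show "((\<lambda>s. flow mul f g x s u) has_real_derivative ?d f g s u) (at s within {0..})"
      "((\<lambda>u. flow mul f g x s u) has_real_derivative ?H s u) (at u within {0..})"
      "((\<lambda>s. ?H s u) has_real_derivative ?K s u) (at s within {0..})"
      using su fg by (intro DERIV_mul_flow DERIV_mul_flow_outer DERIV_add; simp)+
  next
    show "continuous_on {0..} (?H s)" if "s \<ge> 0" for s
      using that fg by (intro continuous_on_add continuous_on_flow_inner[OF regular_prod])
    show "continuous_on ({0..} \<times> {0..}) (\<lambda>(s, u). ?K s u)"
      using continuous_on_flow[OF regular_prod, unfolded case_prod_unfold] 
        continuous_on_flow[OF regular_Gam, unfolded case_prod_unfold] fg
      unfolding case_prod_unfold by (intro continuous_on_add continuous_on_mult_left) auto
  qed (use s u in auto)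
  then have "((\<lambda>u. (?d f g s u - ?H s u) / 2) has_real_derivative
      (?K s u - ((flow mul (L (L f)) g x s u + flow mul (L f) (L g) x s u)
        + (flow mul (L f) (L g) x s u + flow mul f (L (L g)) x s u))) / 2) (at u within {0..})"
    using s u fg by (intro DERIV_cdivide DERIV_diff DERIV_add[OF DERIV_mul_flow DERIV_mul_flow])
  then show ?thesis
    by (simp add: add_divide_distrib)
qed


lemma in_domain_add:
  assumes f: "in_domain U P f" and g: "in_domain U P g"
  shows "in_domain U P (\<lambda>x. f x + g x)"
proof -
  have L: "L (\<lambda>x. f x + g x) = (\<lambda>x. L f x + L g x)"
    using f g by (intro ext twice_differentiable_add) (auto simp: in_domain_def)
  have T: "T t (\<lambda>x. f x + g x) x = T t f x + T t g x"
    "T t (\<lambda>x. L f x + L g x) x = T t (L f) x + T t (L g) x" if "t \<ge> 0" for t x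
    using in_domain_integrable[OF f that] in_domain_integrable[OF g that] by (simp_all add: Q_def)
  have "((\<lambda>s. T s (\<lambda>x. f x + g x) x) has_real_derivative T t (L f) x + T t (L g) x) (at t within {0..})"
    if "t \<ge> 0" for t x
    using DERIV_add[OF DERIV_T[OF f that, of x] DERIV_T[OF g that, of x]]
    by (rule has_field_derivative_transform_within[where d=1]) (use that in \<open>auto simp: T\<close>)
  moreover have "continuous_on {0..} (\<lambda>t. T t (\<lambda>x. L f x + L g x) x)" for x
  proof -
    have "continuous_on {0..} (\<lambda>t. T t (L f) x + T t (L g) x)"
      using f g by (intro continuous_on_add) (auto simp: in_domain_def)
    then show ?thesis by (rule continuous_on_eq) (simp add: T)
  qed
  ultimately show ?thesis
    using f g twice_differentiable_add(1)[of f g] unfolding in_domain_def L by (auto simp: T)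
qed

abbreviation pot :: "(real ^ 'n \<Rightarrow> real) \<Rightarrow> (real ^ 'n \<Rightarrow> real) \<Rightarrow> real ^ 'n \<Rightarrow> real"
  where "pot f g x \<equiv> (W x)\<^sup>2 * f x * g x"

lemma DERIV_pot_flow:
  assumes "f \<in> A" "g \<in> A" "s \<ge> 0" "u \<ge> 0"
  shows "((\<lambda>u. flow pot f g x s u) has_real_derivative flow pot (L f) g x s u + flow pot f (L g) x s u)
    (at u within {0..})"
  using assms potential
  by (intro DERIV_product_flow regular_potential)
     (auto intro: twice_differentiable_continuous_on simp: in_domain_def)

lemma GamW_sum: "GamW U W f g = (\<lambda>x. Gam U f g x + pot f g x)"
  by (auto simp: GamW_def)

lemma GamW_commute: "GamW U W f g = GamW U W g f"
  by (auto simp: GamW_def Gam_def algebra_simps)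

lemma form_integrable:
  assumes "regular_form U P A B" "f \<in> A" "g \<in> A" "t \<ge> 0"
  shows "integrable (P t x) (B f g)"
  using assms by (auto simp: regular_form_def intro: in_domain_integrable)

lemma flow_GamW:
  assumes "f \<in> A" "g \<in> A" "s \<ge> 0" "u \<ge> 0"
  shows "flow (GamW U W) f g x s u = flow (Gam U) f g x s u + flow pot f g x s u"
  using form_integrable[OF regular_Gam T_A T_A] form_integrable[OF regular_potential T_A T_A] assms
  by (simp add: flow_def GamW_sum Q_def[of P s])

lemma regular_GamW: "regular_form U P A (GamW U W)"
proof -
  have "in_domain U P (GamW U W f g)" if "f \<in> A" "g \<in> A" for f g
    unfolding GamW_sum using regular_Gam regular_potential that
    by (intro in_domain_add) (auto simp: regular_form_def)
  moreover have "continuous_on ({0..} \<times> {0..}) (\<lambda>(s, u). flow (GamW U W) f g x s u)" if "f \<in> A" "g \<in> A" for f g x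
  proof -
    have "continuous_on ({0..} \<times> {0..}) (\<lambda>z. (\<lambda>(s, u). flow (Gam U) f g x s u) z + (\<lambda>(s, u). flow pot f g x s u) z)"
      using that by (intro continuous_on_add continuous_on_flow regular_Gam regular_potential)
    then show ?thesis
      by (rule continuous_on_eq) (use that in \<open>auto simp: flow_GamW\<close>)
  qed
  ultimately show ?thesis by (auto simp: regular_form_def flow_def)
qed

lemma DERIV_GamW_flow:
  assumes f: "f \<in> A" and g: "g \<in> A" and s: "s \<ge> 0" and u: "u \<ge> 0"
  shows "((\<lambda>u. flow (GamW U W) f g x s u) has_real_derivative
    flow (GamW U W) (L f) g x s u + flow (GamW U W) f (L g) x s u) (at u within {0..})"
  by (rule DERIV_cong[OF has_field_derivative_transform_within[OF
        DERIV_add[OF DERIV_Gam_flow[OF assms] DERIV_pot_flow[OF assms]], where d=1]])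
     (use f g s u in \<open>auto simp: flow_GamW L_A\<close>)

text \<open>The Leibniz rule in \<open>u\<close> is a premise so that the lemma serves the product and \<open>\<Gamma>\<^sup>W\<close> alike.\<close>

lemma flow_derivative:
  assumes B: "regular_form U P A B"
    and leibniz: "\<And>f g s u. f \<in> A \<Longrightarrow> g \<in> A \<Longrightarrow> s \<ge> 0 \<Longrightarrow> u \<ge> 0 \<Longrightarrow>
      ((\<lambda>u. flow B f g x s u) has_real_derivative flow B (L f) g x s u + flow B f (L g) x s u) (at u within {0..})"
    and f: "f \<in> A" and g: "g \<in> A" and s: "s \<ge> 0" and u: "u \<ge> 0"
  shows "((\<lambda>(s, u). flow B f g x s u) has_derivative
    (\<lambda>(p, q). T s (L (B (T u f) (T u g))) x * p + (flow B (L f) g x s u + flow B f (L g) x s u) * q))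
    (at (s, u) within {0..} \<times> {0..})"
proof (rule has_derivative_quadrant[OF DERIV_flow_outer[OF B f g s u] leibniz[OF f g] _ s u])
  have "continuous_on ({0..} \<times> {0..}) (\<lambda>z. (\<lambda>(s, u). flow B (L f) g x s u) z + (\<lambda>(s, u). flow B f (L g) x s u) z)"
    using f g by (intro continuous_on_add continuous_on_flow B L_A)
  then show "continuous_on ({0..} \<times> {0..}) (\<lambda>(s, u). flow B (L f) g x s u + flow B f (L g) x s u)"
    by (simp add: case_prod_unfold)
qed

lemmas DERIV_flow_antidiagonal = DERIV_antidiagonal[OF flow_derivative]

lemma continuous_on_flow_antidiagonal:
  assumes "regular_form U P A B" "f \<in> A" "g \<in> A"
  shows "continuous_on {0..t} (\<lambda>s. flow B f g x s (t - s))"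
proof -
  have "continuous_on {0..t} (\<lambda>s. (s, t - s))" by (intro continuous_intros)
  moreover have "(\<lambda>s. (s, t - s)) ` {0..t} \<subseteq> {0..} \<times> {0..}" by auto
  ultimately show ?thesis
    using continuous_on_compose2[OF continuous_on_flow[OF assms]] by fastforce
qed

section \<open>Identities along the antidiagonal\<close>

lemma variance_identity:
  assumes f: "f \<in> A" and t: "t \<ge> 0"
  shows "T t (\<lambda>y. (f y)\<^sup>2) x - (T t f x)\<^sup>2 = 2 * integral {0..t} (\<lambda>s. flow (Gam U) f f x s (t - s))"
proof -
  let ?F = "\<lambda>s. flow mul f f x s (t - s)"
  have "((\<lambda>s. 2 * flow (Gam U) f f x s (t - s)) has_integral ?F t - ?F 0) {0..t}"
  proof (rule fundamental_theorem_of_calculus[OF t])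
    fix s assume s: "s \<in> {0..t}"
    have "(?F has_real_derivative T s (L (mul (T (t - s) f) (T (t - s) f))) x
        - (flow mul (L f) f x s (t - s) + flow mul f (L f) x s (t - s))) (at s within {0..t})"
      using s f by (intro DERIV_flow_antidiagonal DERIV_mul_flow regular_prod) auto
    also have "T s (L (mul (T (t - s) f) (T (t - s) f))) x
        - (flow mul (L f) f x s (t - s) + flow mul f (L f) x s (t - s)) = 2 * flow (Gam U) f f x s (t - s)"
      using s f by (simp add: outer_derivative_mul)
    finally show "(?F has_vector_derivative 2 * flow (Gam U) f f x s (t - s)) (at s within {0..t})"
      by (simp add: has_real_derivative_iff_has_vector_derivative)
  qed
  moreover have "mul (T t f) (T t f) \<in> borel_measurable borel"
    using A_borel_measurable[OF T_A[OF f t]] by measurable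
  then have "?F 0 = (T t f x)\<^sup>2" "?F t = T t (\<lambda>y. (f y)\<^sup>2) x"
    using f by (simp_all add: flow_def T_0 A_borel_measurable power2_eq_square)
  ultimately show ?thesis by (auto dest: integral_unique)
qed

lemma energy_identity:
  assumes f: "f \<in> A" and t: "t \<ge> 0"
  shows "T t (\<lambda>y. (f y)\<^sup>2) x - (T t f x)\<^sup>2
      + 2 * integral {0..t} (\<lambda>s. T s (\<lambda>y. (W y)\<^sup>2 * (T (t - s) f y)\<^sup>2) x)
    = 2 * integral {0..t} (\<lambda>s. flow (GamW U W) f f x s (t - s))"
proof -
  have "integral {0..t} (\<lambda>s. flow (GamW U W) f f x s (t - s))
      = integral {0..t} (\<lambda>s. flow (Gam U) f f x s (t - s) + flow pot f f x s (t - s))"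
    using f by (intro integral_cong) (auto simp: flow_GamW)
  also have "\<dots> = integral {0..t} (\<lambda>s. flow (Gam U) f f x s (t - s)) + integral {0..t} (\<lambda>s. flow pot f f x s (t - s))"
    by (intro integral_add integrable_continuous_real continuous_on_flow_antidiagonal regular_Gam regular_potential f)
  finally show ?thesis
    using variance_identity[OF f t] by (simp add: flow_def power2_eq_square mult.assoc)
qed

lemma Gam2W_T:
  assumes f: "f \<in> A" and u: "u \<ge> 0"
  shows "2 * Gam2W U W (T u f) (T u f) y
    = L (GamW U W (T u f) (T u f)) y - 2 * GamW U W (T u f) (T u (L f)) y"
  using assms GamW_commute[of "T u (L f)" "T u f"] by (simp add: Gam2W_def L_T)

lemma Gam2W_integrable:
  assumes f: "f \<in> A" and t: "t \<ge> 0"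
  shows "integrable (P t x) (Gam2W U W f f)"
proof -
  have "in_domain U P (GamW U W f f)"
    using regular_GamW f by (auto simp: regular_form_def)
  then show ?thesis
    unfolding Gam2W_def
    by (intro Bochner_Integration.integrable_diff integrable_mult_right form_integrable[OF regular_GamW]
        in_domain_integrable(2) f t L_A)
qed

lemma DERIV_GamW_flow_antidiagonal:
  assumes f: "f \<in> A" and s: "s \<in> {0..t}"
  shows "((\<lambda>s. flow (GamW U W) f f x s (t - s)) has_real_derivative
    2 * T s (Gam2W U W (T (t - s) f) (T (t - s) f)) x) (at s within {0..t})"
proof -
  let ?g = "T (t - s) f"
  have g: "?g \<in> A" and s0: "s \<ge> 0" and ts: "t - s \<ge> 0" using f s by (auto intro: T_A)
  have "in_domain U P (GamW U W ?g ?g)"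
    using regular_GamW g by (auto simp: regular_form_def)
  then have "integrable (P s x) (L (GamW U W ?g ?g))"
    using s0 by (rule in_domain_integrable)
  moreover have "integrable (P s x) (GamW U W ?g (T (t - s) (L f)))"
    using g s0 ts f by (intro form_integrable[OF regular_GamW] T_A L_A)
  ultimately have "T s (\<lambda>y. L (GamW U W ?g ?g) y - 2 * GamW U W ?g (T (t - s) (L f)) y) x
      = T s (L (GamW U W ?g ?g)) x - 2 * flow (GamW U W) f (L f) x s (t - s)"
    by (simp add: flow_def Q_def[of P s])
  then have "2 * T s (Gam2W U W ?g ?g) x = T s (L (GamW U W ?g ?g)) x
      - (flow (GamW U W) (L f) f x s (t - s) + flow (GamW U W) f (L f) x s (t - s))"
    unfolding Gam2W_T[OF f ts, symmetric]
    by (simp add: flow_def Q_def[of P s] GamW_commute[of "T (t - s) (L f)"])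
  then show ?thesis
    using DERIV_flow_antidiagonal[OF regular_GamW DERIV_GamW_flow f f, of s t x] s by simp
qed

lemma flow_GamW_ends:
  assumes f: "f \<in> A" and t: "t \<ge> 0"
  shows "flow (GamW U W) f f x 0 t = GamW U W (T t f) (T t f) x"
    and "flow (GamW U W) f f x t 0 = T t (GamW U W f f) x"
proof -
  have "in_domain U P (GamW U W (T t f) (T t f))"
    using regular_GamW f t by (auto simp: regular_form_def T_A)
  then show "flow (GamW U W) f f x 0 t = GamW U W (T t f) (T t f) x"
    using in_domain_borel_measurable[of U P] by (auto simp: flow_def T_0)
  show "flow (GamW U W) f f x t 0 = T t (GamW U W f f) x"
    using f by (simp add: flow_def T_0 A_borel_measurable)
qed

section \<open>The three implications\<close>

lemma gradient_bound_if_curvature: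
  assumes curv: "\<And>f x. f \<in> A \<Longrightarrow> Gam2W U W f f x \<ge> \<rho> * GamW U W f f x"
    and f: "f \<in> A" and t: "t \<ge> 0"
  shows "GamW U W (T t f) (T t f) x \<le> exp (- 2 * \<rho> * t) * T t (GamW U W f f) x"
proof -
  let ?F = "\<lambda>s. flow (GamW U W) f f x s (t - s)"
  let ?D = "\<lambda>s. 2 * T s (Gam2W U W (T (t - s) f) (T (t - s) f)) x"
  have "exp (- 2 * \<rho> * 0) * ?F 0 \<le> exp (- 2 * \<rho> * t) * ?F t"
  proof (rule DERIV_nonneg_imp_increasing_open[OF t])
    fix s assume s: "0 < s" "s < t"
    have "(?F has_real_derivative ?D s) (at s)"
      using DERIV_GamW_flow_antidiagonal[OF f, of s t x] s by (simp add: at_within_Icc_at)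
    then have "((\<lambda>s. exp (- 2 * \<rho> * s) * ?F s) has_real_derivative
        exp (- 2 * \<rho> * s) * (?D s - 2 * \<rho> * ?F s)) (at s)"
      by (auto intro!: derivative_eq_intros simp: algebra_simps)
    moreover have "\<rho> * ?F s \<le> T s (Gam2W U W (T (t - s) f) (T (t - s) f)) x"
    proof -
      have g: "T (t - s) f \<in> A" using f s by (intro T_A) auto
      have "\<rho> * ?F s = (\<integral>y. \<rho> * GamW U W (T (t - s) f) (T (t - s) f) y \<partial>P s x)"
        by (simp add: flow_def Q_def[of P s])
      also have "\<dots> \<le> T s (Gam2W U W (T (t - s) f) (T (t - s) f)) x"
        unfolding Q_def[of P s] using g s curv[OF g]
        by (intro integral_mono integrable_mult_right form_integrable[OF regular_GamW] Gam2W_integrable) auto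
      finally show ?thesis .
    qed
    ultimately show "\<exists>y. ((\<lambda>s. exp (- 2 * \<rho> * s) * ?F s) has_real_derivative y) (at s) \<and> y \<ge> 0"
      by (intro exI[of _ "exp (- 2 * \<rho> * s) * (?D s - 2 * \<rho> * ?F s)"]) simp
  next
    show "continuous_on {0..t} (\<lambda>s. exp (- 2 * \<rho> * s) * ?F s)"
      by (intro continuous_intros continuous_on_flow_antidiagonal regular_GamW f)
  qed
  then show ?thesis
    using flow_GamW_ends[OF f t] by simp
qed

lemma poincare_if_gradient_bound:
  assumes grad: "\<And>f t x. f \<in> A \<Longrightarrow> t \<ge> 0 \<Longrightarrow>
      GamW U W (T t f) (T t f) x \<le> exp (- 2 * \<rho> * t) * T t (GamW U W f f) x"
    and f: "f \<in> A" and t: "t \<ge> 0"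
  shows "2 * integral {0..t} (\<lambda>s. flow (GamW U W) f f x s (t - s))
    \<le> (if \<rho> = 0 then 2 * t else (1 - exp (- 2 * \<rho> * t)) / \<rho>) * T t (GamW U W f f) x"
proof -
  let ?F = "\<lambda>s. flow (GamW U W) f f x s (t - s)"
  let ?c = "if \<rho> = 0 then 2 * t else (1 - exp (- 2 * \<rho> * t)) / \<rho>"
  have "(\<lambda>s. 2 * ?F s) integrable_on {0..t}"
    by (intro integrable_continuous_real continuous_on_mult_left continuous_on_flow_antidiagonal regular_GamW f)
  then have "((\<lambda>s. 2 * ?F s) has_integral 2 * integral {0..t} ?F) {0..t}"
    by (simp add: has_integral_integrable_integral)
  moreover have "((\<lambda>s. 2 * exp (- 2 * \<rho> * (t - s)) * T t (GamW U W f f) x) has_integral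
      ?c * T t (GamW U W f f) x) {0..t}"
    using has_integral_mult_left[OF curvature_factor_integral[OF t]] by blast
  ultimately show ?thesis
  proof (rule has_integral_le)
    fix s assume s: "s \<in> {0..t}"
    have int: "integrable (P r z) (GamW U W f f)" if "r \<ge> 0" for r z
      using that f by (intro form_integrable[OF regular_GamW])
    have "?F s \<le> (\<integral>y. exp (- 2 * \<rho> * (t - s)) * T (t - s) (GamW U W f f) y \<partial>P s x)"
      unfolding flow_def Q_def[of P s] using s f grad int
      by (intro integral_mono integrable_mult_right T_T(2) form_integrable[OF regular_GamW] T_A) auto
    also have "\<dots> = exp (- 2 * \<rho> * (t - s)) * T s (T (t - s) (GamW U W f f)) x"
      by (simp add: Q_def[of P s])
    also have "T s (T (t - s) (GamW U W f f)) x = T t (GamW U W f f) x"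
      using T_T(1)[of s "t - s" "GamW U W f f" x] s int by simp
    finally show "2 * ?F s \<le> 2 * exp (- 2 * \<rho> * (t - s)) * T t (GamW U W f f) x"
      by simp
  qed
qed

text \<open>Write \<open>q t = Q\<^sub>t(\<Gamma>\<^sup>W(f))(x)\<close>, \<open>a = q' 0\<close> and \<open>b\<close> for the \<open>u\<close>-derivative of the flow at the corner. The
  Poincare inequality compares \<open>c t * q t = 2 t q(0) + t\<^sup>2 (2 a - 2 \<rho> q(0)) + o(t\<^sup>2)\<close> with
  \<open>2 t q(0) + t\<^sup>2 (a + b) + o(t\<^sup>2)\<close>, whence \<open>a - b \<ge> 2 \<rho> q(0)\<close>, and \<open>a - b\<close> is twice \<open>\<Gamma>\<^sub>2\<^sup>W(f)(x)\<close>.\<close>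

lemma curvature_if_poincare:
  assumes poincare: "\<And>t. t \<ge> 0 \<Longrightarrow> 2 * integral {0..t} (\<lambda>s. flow (GamW U W) f f x s (t - s))
      \<le> (if \<rho> = 0 then 2 * t else (1 - exp (- 2 * \<rho> * t)) / \<rho>) * T t (GamW U W f f) x"
    and f: "f \<in> A"
  shows "Gam2W U W f f x \<ge> \<rho> * GamW U W f f x"
proof -
  let ?F = "flow (GamW U W) f f x"
  define c where "c t = (if \<rho> = 0 then 2 * t else (1 - exp (- 2 * \<rho> * t)) / \<rho>)" for t
  define q where "q t = T t (GamW U W f f) x" for t
  define I where "I t = integral {0..t} (\<lambda>s. ?F s (t - s))" for t
  let ?a = "L (GamW U W f f) x" and ?b = "2 * GamW U W f (L f) x"
  have T0: "T 0 f = f" "T 0 (L f) = L f"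
    using f by (auto intro: T_0 A_borel_measurable L_A)
  have dom: "in_domain U P (GamW U W f f)" "in_domain U P (GamW U W f (L f))"
    using regular_GamW f L_A by (auto simp: regular_form_def)
  have Lm: "L (GamW U W f f) \<in> borel_measurable borel"
    using borel_measurable_integrable[OF in_domain_integrable(2)[OF dom(1), of 0]] sets_kernel[of 0]
    by (simp cong: measurable_cong_sets)
  have q0: "q 0 = GamW U W f f x" "?F 0 0 = q 0"
    using in_domain_borel_measurable[OF dom(1)] T0 by (simp_all add: q_def T_0 flow_def)
  have "(q has_real_derivative ?a) (at 0 within {0..})"
    using DERIV_T[OF dom(1), of 0 x] Lm unfolding q_def by (simp add: T_0)
  then have "(q has_real_derivative ?a) (at_right 0)"
    by (rule DERIV_subset) auto
  then have q': "((\<lambda>t. (q t - q 0) / t) \<longlongrightarrow> ?a) (at_right 0)"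
    by (simp add: has_field_derivative_iff)
  have "((\<lambda>(s, u). ?F s u) has_derivative (\<lambda>(p, r). ?a * p + ?b * r)) (at (0, 0) within {0..} \<times> {0..})"
    using flow_derivative[OF regular_GamW DERIV_GamW_flow f f, of 0 0 x] T0
      in_domain_borel_measurable[OF dom(2)] Lm
    by (simp add: flow_def T_0 GamW_commute[of "L f"])
  then have I': "((\<lambda>t. (I t - t * q 0) / t\<^sup>2) \<longlongrightarrow> (?a + ?b) / 2) (at_right 0)"
    unfolding I_def q0(2)[symmetric]
    by (rule tendsto_antidiagonal_integral) (intro continuous_on_flow_antidiagonal regular_GamW f)
  have lim: "((\<lambda>t. c t / t * ((q t - q 0) / t) + q 0 * ((c t - 2 * t) / t\<^sup>2) - 2 * ((I t - t * q 0) / t\<^sup>2))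
      \<longlongrightarrow> 2 * ?a + q 0 * (- 2 * \<rho>) - 2 * ((?a + ?b) / 2)) (at_right 0)"
    using curvature_factor_asymptotics[of \<rho>] unfolding c_def by (intro tendsto_intros q' I')
  have "0 \<le> c t / t * ((q t - q 0) / t) + q 0 * ((c t - 2 * t) / t\<^sup>2) - 2 * ((I t - t * q 0) / t\<^sup>2)"
    if "t > 0" for t
  proof -
    have "0 \<le> (c t * q t - 2 * I t) / t\<^sup>2"
      using poincare[of t] that unfolding I_def c_def q_def by simp
    also have "\<dots> = c t / t * ((q t - q 0) / t) + q 0 * ((c t - 2 * t) / t\<^sup>2) - 2 * ((I t - t * q 0) / t\<^sup>2)"
      using that by (simp add: field_simps power2_eq_square)
    finally show ?thesis .
  qed
  then have "0 \<le> 2 * ?a + q 0 * (- 2 * \<rho>) - 2 * ((?a + ?b) / 2)"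
    by (intro tendsto_lowerbound[OF lim]) (auto simp: eventually_at_right_field intro: exI[of _ 1])
  then show ?thesis
    using Gam2W_T[OF f order.refl, of x] T0 q0 by (simp add: field_simps)
qed

end

section \<open>Equivalence\<close>

theorem theorem1:
  fixes U W :: "real ^ 'n \<Rightarrow> real"
    and P :: "real \<Rightarrow> real ^ 'n \<Rightarrow> (real ^ 'n) measure"
    and A :: "(real ^ 'n \<Rightarrow> real) set"
    and \<rho> :: real
  assumes "twice_differentiable U"
    and "has_bochner_integral lborel (\<lambda>x. exp (- U x)) 1"
    and "semigroup_generated_by U P"
    and "\<And>x. W x \<ge> 0"
    and "in_domain U P (\<lambda>x. (W x)\<^sup>2)"
    and "smooth_class U W P A"
  defines "i \<equiv> \<forall>f\<in>A. \<forall>x. Gam2W U W f f x \<ge> \<rho> * GamW U W f f x"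
    and "ii \<equiv> \<forall>f\<in>A. \<forall>t\<ge>0. \<forall>x.
           GamW U W (Q P t f) (Q P t f) x \<le> exp (- 2 * \<rho> * t) * Q P t (GamW U W f f) x"
    and "iii \<equiv> \<forall>f\<in>A. \<forall>t\<ge>0. \<forall>x.
           Q P t (\<lambda>y. (f y)\<^sup>2) x - (Q P t f x)\<^sup>2
             + 2 * integral {0..t} (\<lambda>s. Q P s (\<lambda>y. (W y)\<^sup>2 * (Q P (t - s) f y)\<^sup>2) x)
           \<le> (if \<rho> = 0 then 2 * t else (1 - exp (- 2 * \<rho> * t)) / \<rho>) * Q P t (GamW U W f f) x"
  shows "(i \<longleftrightarrow> ii) \<and> (ii \<longleftrightarrow> iii)"
proof -
  interpret smooth_semigroup U W P A
    using assms(3,5,6) by unfold_locales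
  have "ii" if "i"
    using that gradient_bound_if_curvature[of \<rho>] unfolding i_def ii_def by blast
  moreover have "iii" if "ii"
    unfolding iii_def
  proof (intro ballI allI impI)
    fix f t x assume f: "f \<in> A" and t: "t \<ge> (0::real)"
    show "Q P t (\<lambda>y. (f y)\<^sup>2) x - (Q P t f x)\<^sup>2
             + 2 * integral {0..t} (\<lambda>s. Q P s (\<lambda>y. (W y)\<^sup>2 * (Q P (t - s) f y)\<^sup>2) x)
           \<le> (if \<rho> = 0 then 2 * t else (1 - exp (- 2 * \<rho> * t)) / \<rho>) * Q P t (GamW U W f f) x"
      unfolding energy_identity[OF f t]
      by (rule poincare_if_gradient_bound[OF _ f t]) (use that in \<open>auto simp: ii_def\<close>)
  qed
  moreover have "i" if "iii"
    unfolding i_def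
  proof (intro ballI allI)
    fix f x assume f: "f \<in> A"
    show "Gam2W U W f f x \<ge> \<rho> * GamW U W f f x"
      by (rule curvature_if_poincare[OF _ f])
         (use that f energy_identity[OF f] in \<open>auto simp: iii_def\<close>)
  qed
  ultimately show ?thesis by blast
qed

end
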